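(* Assume that $\Omega$ is convex. Let $V\subset\Omega$ have finite cardinality and let $T:\Omega\to V$ be a map. Define $\mathbb G_s$ to be the simple graph on $V$ such that two vertices $x,y$ are adjacent when $x\ne y$ and $|x-y|\le s$. Then $\mathbb G_s$ is connected for every $s\ge2\sqrt d\,\sup_{x\in\Omega}|T(x)-x|$.
   Context: $d\in\mathbb N=\{1,2,\dots\}$ and $\Omega\subset\mathbb R^d$ is open and bounded with Lipschitz boundary. $|\cdot|$ is the Euclidean norm. *)

theory Defs
  imports "HOL-Analysis.Analysis" "Graph_Theory.Digraph_Component"
begin

(* Near each boundary point, S is the open region above the graph of a Lipschitz function of
   d - 1 variables in a rotated Cartesian coordinate system. The last coordinate axis is spanned
   by the unit vector e, and the other d - 1 coordinates of x are represented by the orthogonal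
   projection of x to the hyperplane orthogonal to e (for d = 1, this hyperplane is {0}). *)

definition lipschitz_boundary :: "'a::euclidean_space set \<Rightarrow> bool" where
  "lipschitz_boundary S \<longleftrightarrow>
     (\<forall>p\<in>frontier S. \<exists>r>0. \<exists>e g L. norm e = 1 \<and> lipschitz_on L {y. y \<bullet> e = 0} g \<and>
        S \<inter> ball p r = {x \<in> ball p r. g (x - (x \<bullet> e) *\<^sub>R e) < x \<bullet> e})"

(* An undirected edge is represented by its two arcs, as in the locale pair_graph. *)

definition proximity_graph :: "'a::real_normed_vector set \<Rightarrow> real \<Rightarrow> 'a pair_pre_digraph" where
  "proximity_graph V s =
     \<lparr> pverts = V, parcs = {(x, y). x \<in> V \<and> y \<in> V \<and> x \<noteq> y \<and> norm (x - y) \<le> s} \<rparr>"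

lemma pair_graph_proximity_graph:
  assumes "finite V"
  shows "pair_graph (proximity_graph V s)"
proof -
  have "parcs (proximity_graph V s) \<subseteq> V \<times> V"
    by (auto simp: proximity_graph_def)
  then have "finite (parcs (proximity_graph V s))"
    using assms by (meson finite_SigmaI finite_subset)
  then show ?thesis
    using assms
    by unfold_locales
      (auto simp: proximity_graph_def symmetric_def norm_minus_commute intro!: symI)
qed

end

theory Submission
  imports Defs
begin

text \<open>
  Write \<open>\<rho>\<close> for the supremum of \<open>norm (T x - x)\<close>. The points of a convex set form a connected
  space, and \<open>T\<close> moves each of them by at most \<open>\<rho>\<close>. If \<open>x\<close> and \<open>y\<close> are at distance less than
  \<open>\<delta>\<close>, then \<open>T x\<close> and \<open>T y\<close> are at distance less than \<open>2 * \<rho> + \<delta>\<close>. The finite set \<open>V\<close> has only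
  finitely many distances, so once \<open>\<delta>\<close> is small, \<open>T x\<close> and \<open>T y\<close> are in fact at distance at most
  \<open>2 * \<rho>\<close>. Hence, if \<open>s \<ge> 2 * \<rho>\<close>, the connected component of \<open>T x\<close> in the proximity graph is a
  locally constant function of \<open>x\<close>, and therefore a constant one: the image of \<open>T\<close> lies in a single
  component. A vertex \<open>v\<close> outside the image is still a point of the domain, and it is joined to
  \<open>T v\<close>, which is at distance at most \<open>\<rho> \<le> s\<close>.
\<close>

text \<open>
  Because \<open>T\<close> may be discontinuous, comparing \<open>T x\<close> with \<open>T y\<close> for \<open>y\<close> near \<open>x\<close> always leaves
  an error \<open>norm (x - y)\<close>, and there is no limit to take. The error is absorbed instead by the gap
  between \<open>c\<close> and the next larger distance in \<open>V\<close>; for \<open>c = 2 * \<rho>\<close>, this gives the bound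
  \<open>2 * \<rho>\<close> itself.
\<close>

lemma finite_distance_gap:
  fixes V :: "'a::real_normed_vector set"
  assumes "finite V"
  obtains \<delta> where "\<delta> > 0"
    and "\<And>v w. v \<in> V \<Longrightarrow> w \<in> V \<Longrightarrow> norm (v - w) < c + \<delta> \<Longrightarrow> norm (v - w) \<le> c"
proof -
  have "finite ((\<lambda>(v, w). norm (v - w)) ` (V \<times> V))"
    using assms by simp
  then obtain \<delta> where "\<delta> > 0"
    and \<delta>: "\<forall>r \<in> (\<lambda>(v, w). norm (v - w)) ` (V \<times> V). r \<noteq> c \<longrightarrow> \<delta> \<le> dist c r"
    using finite_set_avoid by blast
  have "norm (v - w) \<le> c" if "v \<in> V" "w \<in> V" "norm (v - w) < c + \<delta>" for v w
  proof (rule ccontr)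
    assume far: "\<not> norm (v - w) \<le> c"
    have "norm (v - w) \<in> (\<lambda>(v, w). norm (v - w)) ` (V \<times> V)"
      using that by force
    with \<delta> far have "\<delta> \<le> dist c (norm (v - w))"
      by auto
    with far that(3) show False
      by (simp add: dist_real_def)
  qed
  with \<open>\<delta> > 0\<close> that show thesis
    by blast
qed

lemma reachable_proximity_graph:
  assumes "finite V" "v \<in> V" "w \<in> V" "norm (v - w) \<le> s"
  shows "v \<rightarrow>\<^sup>*\<^bsub>with_proj (proximity_graph V s)\<^esub> w"
proof -
  interpret pair_graph "proximity_graph V s"
    using assms(1) by (rule pair_graph_proximity_graph)
  show ?thesis
  proof (cases "v = w")
    case True
    have "w \<in> pverts (proximity_graph V s)"
      using assms(3) by (simp add: proximity_graph_def)
    then show ?thesis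
      unfolding True by (rule reachable_refl)
  next
    case False
    with assms have "(v, w) \<in> parcs (proximity_graph V s)"
      by (simp add: proximity_graph_def)
    then show ?thesis
      by (intro reachable_adjI) simp
  qed
qed

text \<open>
  Reachability between \<open>T x\<close> and \<open>T y\<close> is an equivalence relation in \<open>x\<close> and \<open>y\<close> with open
  classes, and a connected set is a single such class.
\<close>

lemma connected_proximity_graph:
  fixes S V :: "'a::real_normed_vector set"
  assumes "Topological_Spaces.connected S" "S \<noteq> {}" "V \<subseteq> S" "finite V" "T \<in> S \<rightarrow> V"
    and near: "\<And>x. x \<in> S \<Longrightarrow> norm (T x - x) \<le> \<rho>"
    and "2 * \<rho> \<le> s"
  shows "Digraph_Component.connected (with_proj (proximity_graph V s))"
proof -
  let ?G = "with_proj (proximity_graph V s)"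
  interpret pair_graph "proximity_graph V s"
    using assms(4) by (rule pair_graph_proximity_graph)
  have verts: "verts ?G = V"
    by (simp add: proximity_graph_def)
  have TV: "T x \<in> V" if "x \<in> S" for x
    using that assms(5) by blast
  obtain \<delta> where "\<delta> > 0"
    and gap: "\<And>v w. v \<in> V \<Longrightarrow> w \<in> V \<Longrightarrow> norm (v - w) < 2 * \<rho> + \<delta> \<Longrightarrow> norm (v - w) \<le> 2 * \<rho>"
    using finite_distance_gap[OF assms(4)] by blast
  have image: "T x \<rightarrow>\<^sup>*\<^bsub>?G\<^esub> T y" if "x \<in> S" "y \<in> S" for x y
  proof (rule connected_equivalence_relation[OF assms(1) that])
    fix x assume x: "x \<in> S"
    have "T x \<rightarrow>\<^sup>*\<^bsub>?G\<^esub> T y" if y: "y \<in> S \<inter> ball x \<delta>" for y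
    proof (rule reachable_proximity_graph[OF assms(4)])
      have "norm (T x - T y) \<le> norm (T x - x) + norm (x - y) + norm (T y - y)"
        by norm
      also have "\<dots> < 2 * \<rho> + \<delta>"
        using near[of x] near[of y] x y by (simp add: dist_norm)
      finally show "norm (T x - T y) \<le> s"
        using gap TV x y assms(7) by fastforce
    qed (use TV x y in auto)
    then show "\<exists>U. openin (top_of_set S) U \<and> x \<in> U \<and> (\<forall>y\<in>U. T x \<rightarrow>\<^sup>*\<^bsub>?G\<^esub> T y)"
      using x \<open>\<delta> > 0\<close> by (intro exI[of _ "S \<inter> ball x \<delta>"]) (auto simp: openin_open_Int)
  qed (blast intro: symmetric_reachable' reachable_trans)+
  have vertex: "T v \<rightarrow>\<^sup>*\<^bsub>?G\<^esub> v" if "v \<in> V" for v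
  proof (rule reachable_proximity_graph[OF assms(4)])
    have "v \<in> S"
      using that assms(3) by blast
    then show "T v \<in> V"
      by (rule TV)
    show "norm (T v - v) \<le> s"
      using near[OF \<open>v \<in> S\<close>] norm_ge_zero[of "T v - v"] assms(7) by linarith
  qed (fact that)
  have "u \<rightarrow>\<^sup>*\<^bsub>?G\<^esub> v" if "u \<in> V" "v \<in> V" for u v
    using vertex[OF that(1)] vertex[OF that(2)] image[of u v] that assms(3)
    by (blast intro: symmetric_reachable' reachable_trans)
  moreover have "V \<noteq> {}"
    using TV assms(2) by blast
  ultimately show ?thesis
    unfolding Digraph_Component.connected_def strongly_connected_def
    using verts by (auto intro: reachable_mk_symmetricI)
qed

theorem proposition4p6:
  fixes \<Omega> V :: "(real ^ 'd) set"
    and T :: "real ^ 'd \<Rightarrow> real ^ 'd"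
    and s :: real
  assumes "open \<Omega>" and "bounded \<Omega>" and "\<Omega> \<noteq> {}" and "lipschitz_boundary \<Omega>"
    and "convex \<Omega>"
    and "V \<subseteq> \<Omega>" and "finite V"
    and "T \<in> \<Omega> \<rightarrow> V"
    and "s \<ge> 2 * sqrt (real CARD('d)) * (SUP x\<in>\<Omega>. norm (T x - x))"
  shows "Digraph_Component.connected (with_proj (proximity_graph V s))"
proof (rule connected_proximity_graph)
  let ?\<rho> = "SUP x\<in>\<Omega>. norm (T x - x)"
  \<comment> \<open>A supremum of reals is an upper bound only if the set is bounded above.\<close>
  have "bounded ((\<lambda>x. T x - x) ` \<Omega>)"
    using assms(2,7,8) by (intro bounded_minus_comp) (auto intro: bounded_subset finite_imp_bounded)
  then have bdd: "bdd_above ((\<lambda>x. norm (T x - x)) ` \<Omega>)"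
    by (auto simp: bounded_iff bdd_above_def)
  show near: "norm (T x - x) \<le> ?\<rho>" if "x \<in> \<Omega>" for x
    using that bdd by (rule cSUP_upper)
  obtain x where "x \<in> \<Omega>"
    using assms(3) by blast
  then have "0 \<le> ?\<rho>"
    using near norm_ge_zero order_trans by blast
  moreover have "1 \<le> sqrt (real CARD('d))"
    by (simp add: Suc_leI)
  ultimately have "2 * ?\<rho> \<le> 2 * sqrt (real CARD('d)) * ?\<rho>"
    by (simp add: mult_le_cancel_right1 mult_right_mono)
  with assms(9) show "2 * ?\<rho> \<le> s"
    by linarith
qed (use assms convex_connected in auto)

end
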